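(* Let $(X,\|\cdot\|)$ be a complex normed space with topological dual $X^*$, and let $x,y\in X$. Then $$|\rho_{\infty}(x,y)|\leq \bigl(1+2\mathcal{R}(X^* )\bigr)\|x\|\,\|y\|.$$
   Context: For a complex normed space $X$ and $x,y\in X$, the right norm derivative is $\rho_{+}(x,y)=\lim_{t\to0^{+}}\frac{\|x+ty\|^2-\|x\|^2}{2t}\in\mathbb{R}$, and $$\rho_{\infty}(x,y)=\frac1\pi\int_0^{2\pi}e^{i\theta}\rho_{+}(x,e^{i\theta}y)\,d\theta\in\mathbb{C}.$$ For a normed space $Z$ with unit sphere $S_Z$, $\mathcal{R}(Z):=\sup\{\|u-v\|:\ \mathrm{conv}\{u,v\}\subseteq S_Z\}$, where $\mathrm{conv}\{u,v\}$ is the closed line segment joining $u$ and $v$. The dual $X^*$ carries the usual dual norm. *)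

theory Defs
  imports "HOL-Analysis.Analysis"
begin

class complex_normed_vector = real_normed_vector +
  fixes scaleC :: "complex \<Rightarrow> 'a \<Rightarrow> 'a" (infixr "*\<^sub>C" 75)
  assumes scaleC_add_right: "c *\<^sub>C (x + y) = c *\<^sub>C x + c *\<^sub>C y"
    and scaleC_add_left: "(c + d) *\<^sub>C x = c *\<^sub>C x + d *\<^sub>C x"
    and scaleC_scaleC: "c *\<^sub>C d *\<^sub>C x = (c * d) *\<^sub>C x"
    and scaleC_of_real: "complex_of_real r *\<^sub>C x = r *\<^sub>R x"
    and norm_scaleC: "norm (c *\<^sub>C x) = cmod c * norm x"

instantiation complex :: complex_normed_vector
begin

definition scaleC_complex :: "complex \<Rightarrow> complex \<Rightarrow> complex"
  where "scaleC_complex c z = c * z"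

instance
  by standard (simp_all add: scaleC_complex_def algebra_simps scaleR_conv_of_real norm_mult)

end

text \<open>The topological dual: bounded complex-linear functionals. The library's \<^const>\<open>bounded_linear\<close>
  is real-linear, so complex homogeneity is required separately.\<close>

typedef (overloaded) 'a dual =
  "{f :: 'a::complex_normed_vector \<Rightarrow> complex.
      bounded_linear f \<and> (\<forall>c x. f (c *\<^sub>C x) = c * f x)}"
  morphisms dual_apply Abs_dual
  by (rule exI[of _ "\<lambda>_. 0"]) simp

setup_lifting type_definition_dual

lemma bounded_linear_dual_apply: "bounded_linear (dual_apply f)"
  using dual_apply[of f] by simp

lemma dual_apply_scaleC: "dual_apply f (c *\<^sub>C x) = c * dual_apply f x"
  using dual_apply[of f] by simp

lemma dual_eqI: "(\<And>x. dual_apply f x = dual_apply g x) \<Longrightarrow> f = g"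
  by (simp add: dual_apply_inject[symmetric] fun_eq_iff)

instantiation dual :: (complex_normed_vector) complex_normed_vector
begin

lift_definition zero_dual :: "'a dual" is "\<lambda>_. 0"
  by simp

lift_definition plus_dual :: "'a dual \<Rightarrow> 'a dual \<Rightarrow> 'a dual" is "\<lambda>f g x. f x + g x"
  by (auto simp: algebra_simps intro: bounded_linear_add)

lift_definition minus_dual :: "'a dual \<Rightarrow> 'a dual \<Rightarrow> 'a dual" is "\<lambda>f g x. f x - g x"
  by (auto simp: algebra_simps intro: bounded_linear_sub)

lift_definition uminus_dual :: "'a dual \<Rightarrow> 'a dual" is "\<lambda>f x. - f x"
  by (auto intro: bounded_linear_minus)

lift_definition scaleR_dual :: "real \<Rightarrow> 'a dual \<Rightarrow> 'a dual" is "\<lambda>r f x. r *\<^sub>R f x"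
  by (auto intro: bounded_linear_const_scaleR)

lift_definition scaleC_dual :: "complex \<Rightarrow> 'a dual \<Rightarrow> 'a dual" is "\<lambda>c f x. c * f x"
  by (auto intro: bounded_linear_const_mult)

lift_definition norm_dual :: "'a dual \<Rightarrow> real" is onorm .

definition dist_dual :: "'a dual \<Rightarrow> 'a dual \<Rightarrow> real"
  where "dist_dual f g = norm (f - g)"

definition sgn_dual :: "'a dual \<Rightarrow> 'a dual"
  where "sgn_dual f = inverse (norm f) *\<^sub>R f"

definition uniformity_dual :: "('a dual \<times> 'a dual) filter"
  where "uniformity_dual = (INF e\<in>{0<..}. principal {(f, g). dist f g < e})"

definition open_dual :: "'a dual set \<Rightarrow> bool"
  where "open_dual U = (\<forall>f\<in>U. \<forall>\<^sub>F (f', g) in uniformity. f' = f \<longrightarrow> g \<in> U)"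

instance
proof
  fix f g h :: "'a dual" and r s :: real and c d :: complex
  show "dist f g = norm (f - g)" by (fact dist_dual_def)
  show "sgn f = inverse (norm f) *\<^sub>R f" by (fact sgn_dual_def)
  show "uniformity = (INF e\<in>{0<..}. principal {(f :: 'a dual, g). dist f g < e})"
    by (fact uniformity_dual_def)
  show "open U = (\<forall>f\<in>U. \<forall>\<^sub>F (f', g) in uniformity. f' = f \<longrightarrow> g \<in> U)" for U :: "'a dual set"
    by (fact open_dual_def)
  show "f + g + h = f + (g + h)" by transfer (simp add: add.assoc)
  show "f + g = g + f" by transfer (simp add: add.commute)
  show "0 + f = f" by transfer simp
  show "- f + f = 0" by transfer simp
  show "f - g = f + - g" by transfer simp
  show "r *\<^sub>R (f + g) = r *\<^sub>R f + r *\<^sub>R g" by transfer (simp add: algebra_simps)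
  show "(r + s) *\<^sub>R f = r *\<^sub>R f + s *\<^sub>R f" by transfer (simp add: algebra_simps)
  show "r *\<^sub>R s *\<^sub>R f = (r * s) *\<^sub>R f" by transfer simp
  show "1 *\<^sub>R f = f" by transfer simp
  show "norm f = 0 \<longleftrightarrow> f = 0" by transfer (auto simp: onorm_eq_0 fun_eq_iff)
  show "norm (f + g) \<le> norm f + norm g" by transfer (auto intro: onorm_triangle)
  show "norm (r *\<^sub>R f) = \<bar>r\<bar> * norm f" by transfer (auto intro: onorm_scaleR)
  show "c *\<^sub>C (f + g) = c *\<^sub>C f + c *\<^sub>C g" by transfer (simp add: algebra_simps)
  show "(c + d) *\<^sub>C f = c *\<^sub>C f + d *\<^sub>C f" by transfer (simp add: algebra_simps)
  show "c *\<^sub>C d *\<^sub>C f = (c * d) *\<^sub>C f" by transfer (simp add: algebra_simps)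
  show "complex_of_real r *\<^sub>C f = r *\<^sub>R f" by transfer (simp add: scaleR_conv_of_real)
  show "norm (c *\<^sub>C f) = cmod c * norm f"
  proof transfer
    fix c and f :: "'a \<Rightarrow> complex"
    assume "bounded_linear f \<and> (\<forall>c x. f (c *\<^sub>C x) = c * f x)"
    then have f: "bounded_linear f" by simp
    have "onorm (\<lambda>x. c * f x) = onorm (\<lambda>x. cmod c *\<^sub>R f x)"
      by (simp add: onorm_def norm_mult)
    then show "onorm (\<lambda>x. c * f x) = cmod c * onorm f"
      using onorm_scaleR[OF f, of "cmod c"] by simp
  qed
qed

end

text \<open>The limit always exists, because the norm is convex; and it is continuous in the second argument, so the
  integral below is over a continuous function.\<close>

definition rho_plus :: "'a::real_normed_vector \<Rightarrow> 'a \<Rightarrow> real"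
  where "rho_plus x y = Lim (at_right 0) (\<lambda>t. ((norm (x + t *\<^sub>R y))\<^sup>2 - (norm x)\<^sup>2) / (2 * t))"

definition rho_infty :: "'a::complex_normed_vector \<Rightarrow> 'a \<Rightarrow> complex"
  where "rho_infty x y =
    complex_of_real (1 / pi) *
      integral {0..2 * pi} (\<lambda>\<theta>. exp (\<i> * complex_of_real \<theta>) *
        complex_of_real (rho_plus x (exp (\<i> * complex_of_real \<theta>) *\<^sub>C y)))"

text \<open>For a nontrivial space the set below contains 0 and is bounded by 2, so the supremum is
  a genuine one. In the zero space the unit sphere is empty and the value is unspecified.\<close>

definition sphere_flatness :: "'z::real_normed_vector itself \<Rightarrow> real"
  where "sphere_flatness Z = Sup {norm (u - v) |u v :: 'z. closed_segment u v \<subseteq> sphere 0 1}"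

end

theory Submission
  imports Defs
begin

text \<open>
  Every norm-one functional supporting \<open>x\<close> lies within \<open>\<R>(X\<^sup>*)\<close> of any other one, because the segment
  joining them stays in the dual sphere. By Hahn--Banach, \<open>\<rho>\<^sub>+(x, z) = \<parallel>x\<parallel> Re f(z)\<close> for some supporting
  \<open>f\<close> depending on \<open>z\<close>; replacing it by a fixed supporting \<open>f\<^sub>0\<close> costs at most \<open>\<R>(X\<^sup>*) \<parallel>x\<parallel> \<parallel>z\<parallel>\<close>. With
  \<open>f\<^sub>0\<close> the integral defining \<open>\<rho>\<^sub>\<infinity>(x, y)\<close> is the complex conjugate of \<open>\<parallel>x\<parallel> f\<^sub>0(y)\<close>, and the error
  integrated over a circle contributes at most \<open>2 \<R>(X\<^sup>*) \<parallel>x\<parallel> \<parallel>y\<parallel>\<close>.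
\<close>

section \<open>Sublinear functionals and the Hahn-Banach theorem\<close>

definition sublinear :: "('a::real_vector \<Rightarrow> real) \<Rightarrow> bool"
  where "sublinear p \<longleftrightarrow>
    (\<forall>x y. p (x + y) \<le> p x + p y) \<and> (\<forall>r x. 0 < r \<longrightarrow> p (r *\<^sub>R x) \<le> r * p x) \<and> p 0 = 0"

lemma sublinear_add: "sublinear p \<Longrightarrow> p (x + y) \<le> p x + p y"
  and sublinear_scaleR_le: "sublinear p \<Longrightarrow> 0 < r \<Longrightarrow> p (r *\<^sub>R x) \<le> r * p x"
  and sublinear_zero: "sublinear p \<Longrightarrow> p 0 = 0"
  by (simp_all add: sublinear_def)

text \<open>Applying the inequality to the factor \<open>inverse r\<close> yields its converse. The
  definition can therefore ask for \<open>\<le>\<close> only, which is easier to check for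
  infima.\<close>

lemma sublinear_scaleR:
  assumes p: "sublinear p" and r: "0 \<le> r"
  shows "p (r *\<^sub>R x) = r * p x"
proof (cases "r = 0")
  case False
  then have "0 < r" using r by simp
  then have "p (inverse r *\<^sub>R r *\<^sub>R x) \<le> inverse r * p (r *\<^sub>R x)"
    by (intro sublinear_scaleR_le[OF p]) simp
  with \<open>0 < r\<close> have "r * p x \<le> p (r *\<^sub>R x)"
    by (simp add: field_simps)
  with sublinear_scaleR_le[OF p \<open>0 < r\<close>] show ?thesis by (simp add: antisym)
qed (simp add: sublinear_zero[OF p])

lemma sublinear_minus_ge: "sublinear p \<Longrightarrow> - p (- x) \<le> p x"
  using sublinear_add[of p x "- x"] sublinear_zero[of p] by simp

text \<open>Subadditivity compares \<open>q x + r y\<close> for two different members; in a chain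
  one of them lies below both, and its own subadditivity suffices. The common bound \<open>l\<close>
  makes all the infima genuine.\<close>

lemma sublinear_Inf_chain:
  fixes C :: "('a::real_vector \<Rightarrow> real) set"
  assumes "C \<noteq> {}"
    and sub: "\<And>q. q \<in> C \<Longrightarrow> sublinear q"
    and bdd: "\<And>q x. q \<in> C \<Longrightarrow> l x \<le> q x"
    and chain: "\<And>q r. q \<in> C \<Longrightarrow> r \<in> C \<Longrightarrow> q \<le> r \<or> r \<le> q"
  shows "sublinear (\<lambda>x. INF q\<in>C. q x)"
proof -
  have bb: "bdd_below ((\<lambda>q. q x) ` C)" for x
    using bdd by (intro bdd_belowI2[where m = "l x"])
  have add: "(INF q\<in>C. q (x + y)) \<le> (INF q\<in>C. q x) + (INF q\<in>C. q y)" for x y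
  proof -
    have *: "(INF q\<in>C. q (x + y)) \<le> q x + r y" if "q \<in> C" "r \<in> C" for q r
    proof -
      have "\<exists>s\<in>C. s \<le> q \<and> s \<le> r" using chain[OF that] that by blast
      then obtain s where s: "s \<in> C" "s \<le> q" "s \<le> r" by blast
      have "(INF q\<in>C. q (x + y)) \<le> s (x + y)"
        using bb s(1) by (rule cINF_lower)
      also have "\<dots> \<le> s x + s y" using sub s(1) by (blast intro: sublinear_add)
      also have "\<dots> \<le> q x + r y" using s(2,3) by (simp add: add_mono le_funD)
      finally show ?thesis .
    qed
    have "(INF q\<in>C. q (x + y)) - r y \<le> (INF q\<in>C. q x)" if "r \<in> C" for r
      using * that \<open>C \<noteq> {}\<close> by (intro cINF_greatest) (auto simp: algebra_simps)
    then have "(INF q\<in>C. q (x + y)) - (INF q\<in>C. q x) \<le> (INF r\<in>C. r y)"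
      using \<open>C \<noteq> {}\<close> by (intro cINF_greatest) (auto simp: algebra_simps)
    then show ?thesis by simp
  qed
  have scale: "(INF q\<in>C. q (r *\<^sub>R x)) \<le> r * (INF q\<in>C. q x)" if "0 < r" for r x
  proof -
    have "(INF q\<in>C. q (r *\<^sub>R x)) / r \<le> (INF q\<in>C. q x)"
    proof (rule cINF_greatest[OF \<open>C \<noteq> {}\<close>])
      fix q assume q: "q \<in> C"
      have "(INF q\<in>C. q (r *\<^sub>R x)) \<le> q (r *\<^sub>R x)" using bb q by (rule cINF_lower)
      also have "\<dots> \<le> r * q x" using sub[OF q] that by (rule sublinear_scaleR_le)
      finally show "(INF q\<in>C. q (r *\<^sub>R x)) / r \<le> q x" using that by (simp add: field_simps)
    qed
    with that show ?thesis by (simp add: field_simps)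
  qed
  have "(INF q\<in>C. q 0) = (INF q\<in>C. 0 :: real)"
    using sub by (intro INF_cong) (auto simp: sublinear_zero)
  then show ?thesis
    using add scale \<open>C \<noteq> {}\<close> by (simp add: sublinear_def)
qed

text \<open>For sublinear \<open>p\<close> this is the largest sublinear functional below
  \<open>p\<close> whose value at \<open>- y\<close> is at most \<open>- p y\<close>.\<close>

definition tilt :: "('a::real_vector \<Rightarrow> real) \<Rightarrow> 'a \<Rightarrow> 'a \<Rightarrow> real"
  where "tilt p y x = (INF t\<in>{0..}. p (x + t *\<^sub>R y) - t * p y)"

text \<open>The bound \<open>- p (- x)\<close> is independent of \<open>t\<close>, so the infimum is
  genuine. Subadditivity holds because parameters \<open>s\<close> and \<open>t\<close> combine to
  \<open>s + t\<close>; homogeneity, because \<open>t\<close> for \<open>u\<close> corresponds to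
  \<open>r * t\<close> for \<open>r *\<^sub>R u\<close>.\<close>

lemma
  assumes p: "sublinear p"
  shows tilt_le: "0 \<le> t \<Longrightarrow> tilt p y x \<le> p (x + t *\<^sub>R y) - t * p y"
    and sublinear_tilt: "sublinear (tilt p y)"
proof -
  have low: "- p (- x) \<le> p (x + t *\<^sub>R y) - t * p y" if "0 \<le> t" for x t
    using sublinear_add[OF p, of "x + t *\<^sub>R y" "- x"] sublinear_scaleR[OF p that, of y] by simp
  have bb: "bdd_below ((\<lambda>t. p (x + t *\<^sub>R y) - t * p y) ` {0..})" for x
    using low by (intro bdd_belowI2) auto
  show le: "tilt p y x \<le> p (x + t *\<^sub>R y) - t * p y" if "0 \<le> t" for t x
    unfolding tilt_def using that by (intro cINF_lower[OF bb]) simp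
  have ge: "c \<le> tilt p y x" if "\<And>t. 0 \<le> t \<Longrightarrow> c \<le> p (x + t *\<^sub>R y) - t * p y" for c x
    unfolding tilt_def using that by (intro cINF_greatest) auto
  have add: "tilt p y (u + v) \<le> tilt p y u + tilt p y v" for u v
  proof -
    have *: "tilt p y (u + v) \<le> (p (u + s *\<^sub>R y) - s * p y) + (p (v + t *\<^sub>R y) - t * p y)"
      if "0 \<le> s" "0 \<le> t" for s t
      using le[of "s + t" "u + v"] that sublinear_add[OF p, of "u + s *\<^sub>R y" "v + t *\<^sub>R y"]
      by (simp add: algebra_simps)
    have "tilt p y (u + v) - (p (v + t *\<^sub>R y) - t * p y) \<le> tilt p y u" if "0 \<le> t" for t
      using *[OF _ that] by (intro ge) (simp add: algebra_simps)
    then have "tilt p y (u + v) - tilt p y u \<le> tilt p y v"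
      by (intro ge) (simp add: algebra_simps)
    then show ?thesis by simp
  qed
  have scale: "tilt p y (r *\<^sub>R u) \<le> r * tilt p y u" if r: "0 < r" for r u
  proof -
    have "tilt p y (r *\<^sub>R u) / r \<le> tilt p y u"
    proof (rule ge)
      fix t :: real assume t: "0 \<le> t"
      have "tilt p y (r *\<^sub>R u) \<le> p (r *\<^sub>R (u + t *\<^sub>R y)) - (r * t) * p y"
        using le[of "r * t" "r *\<^sub>R u"] r t by (simp add: algebra_simps)
      also have "\<dots> = r * (p (u + t *\<^sub>R y) - t * p y)"
        using sublinear_scaleR[OF p, of r "u + t *\<^sub>R y"] r
        by (simp only: right_diff_distrib mult.assoc less_imp_le)
      finally show "tilt p y (r *\<^sub>R u) / r \<le> p (u + t *\<^sub>R y) - t * p y"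
        using r by (simp add: field_simps)
    qed
    with r show ?thesis by (simp add: field_simps)
  qed
  have "tilt p y 0 = 0"
  proof (rule antisym)
    show "tilt p y 0 \<le> 0" using le[of 0 0] sublinear_zero[OF p] by simp
    show "0 \<le> tilt p y 0" using low[of _ 0] sublinear_zero[OF p] by (intro ge) simp
  qed
  with add scale show "sublinear (tilt p y)" by (simp add: sublinear_def)
qed

text \<open>A minimal sublinear functional equals all its tilts, which makes it additive.\<close>

lemma minimal_sublinear_linear:
  assumes q: "sublinear q" and min: "\<And>r. sublinear r \<Longrightarrow> r \<le> q \<Longrightarrow> r = q"
  shows "linear q"
proof -
  have "tilt q y \<le> q" for y
    using tilt_le[OF q, of 0] by (simp add: le_fun_def)
  then have "tilt q y = q" for y
    using min sublinear_tilt[OF q] by blast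
  \<comment> \<open>The parameter \<open>t = 1\<close> in the tilt gives
    \<open>q x \<le> q (x + y) - q y\<close>, the reverse of subadditivity.\<close>
  then have "q x + q y \<le> q (x + y)" for x y
    using tilt_le[OF q, of 1 y x] by simp
  then have add: "q (x + y) = q x + q y" for x y
    using sublinear_add[OF q] by (simp add: antisym)
  have minus: "q (- x) = - q x" for x
    using add[of x "- x"] sublinear_zero[OF q] by simp
  have "q (r *\<^sub>R x) = r * q x" for r x
  proof (cases "0 \<le> r")
    case False
    then have "q (- ((- r) *\<^sub>R x)) = r * q x"
      unfolding minus using sublinear_scaleR[OF q, of "- r" x] minus by simp
    then show ?thesis by simp
  qed (rule sublinear_scaleR[OF q])
  with add show ?thesis by (intro linearI) auto
qed

lemma minimal_sublinear_exists:
  fixes p :: "'a::real_vector \<Rightarrow> real"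
  assumes p: "sublinear p"
  obtains q where "sublinear q" "q \<le> p" "\<And>r. sublinear r \<Longrightarrow> r \<le> q \<Longrightarrow> r = q"
proof -
  define A where "A = {q. sublinear q \<and> q \<le> p}"
  \<comment> \<open>Zorn's lemma is applied to the reversed order, so the bound required for a chain
    is its pointwise infimum.\<close>
  have "\<exists>m\<in>A. \<forall>a\<in>A. m \<ge> a \<longrightarrow> a = m"
  proof (rule predicate_Zorn)
    show "partial_order_on A (relation_of (\<ge>) A)"
      by (rule partial_order_on_relation_ofI) auto
    fix C assume C: "C \<in> Chains (relation_of (\<ge>) A)"
    then have CA: "C \<subseteq> A" by (rule Chains_relation_of)
    have chain: "q \<le> r \<or> r \<le> q" if "q \<in> C" "r \<in> C" for q r
      using C that by (auto simp: Chains_def relation_of_def)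
    show "\<exists>u\<in>A. \<forall>a\<in>C. a \<ge> u"
    proof (cases "C = {}")
      case True
      then show ?thesis using p by (auto simp: A_def)
    next
      case False
      have low: "- p (- x) \<le> q x" if "q \<in> C" for q x
      proof -
        have "sublinear q" "q (- x) \<le> p (- x)" using CA that by (auto simp: A_def le_fun_def)
        with sublinear_minus_ge[of q x] show ?thesis by simp
      qed
      let ?u = "\<lambda>x. INF q\<in>C. q x"
      have "sublinear ?u"
        using CA low chain False by (intro sublinear_Inf_chain[where l = "\<lambda>x. - p (- x)"]) (auto simp: A_def)
      moreover have le: "?u \<le> q" if "q \<in> C" for q
        using low that by (intro le_funI cINF_lower bdd_belowI2) auto
      moreover have "?u \<le> p"
      proof -
        obtain q where "q \<in> C" using False by blast
        with le[OF this] CA show ?thesis by (auto simp: A_def intro: order_trans)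
      qed
      ultimately show ?thesis by (auto simp: A_def)
    qed
  qed
  then obtain q where q: "q \<in> A" and min: "\<And>a. a \<in> A \<Longrightarrow> a \<le> q \<Longrightarrow> a = q" by blast
  show thesis
  proof (rule that)
    show "sublinear q" "q \<le> p" using q by (auto simp: A_def)
    then show "r = q" if "sublinear r" "r \<le> q" for r
      using min[of r] that by (auto simp: A_def intro: order_trans)
  qed
qed

text \<open>A minimal sublinear functional below \<open>tilt p y\<close> is linear. Being below the
  tilt gives \<open>g (- y) \<le> - p y\<close>, and linearity turns this into
  \<open>p y \<le> g y\<close>.\<close>

lemma Hahn_Banach_sublinear:
  fixes p :: "'a::real_vector \<Rightarrow> real"
  assumes p: "sublinear p"
  obtains g where "linear g" "\<And>x. g x \<le> p x" "g y = p y"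
proof -
  obtain g where g: "sublinear g" "g \<le> tilt p y" "\<And>r. sublinear r \<Longrightarrow> r \<le> g \<Longrightarrow> r = g"
    using minimal_sublinear_exists[OF sublinear_tilt[OF p]] by blast
  have lin: "linear g" using g(1,3) by (rule minimal_sublinear_linear)
  have le: "g x \<le> p (x + t *\<^sub>R y) - t * p y" if "0 \<le> t" for x t
    using le_funD[OF g(2), of x] tilt_le[OF p that, of y x] by simp
  have le': "g x \<le> p x" for x using le[of 0] by simp
  have "g (- y) \<le> - p y" using le[of 1 "- y"] sublinear_zero[OF p] by simp
  then have "g y = p y" using le'[of y] linear_neg[OF lin] by (simp add: antisym)
  with lin le' that show thesis by blast
qed

section \<open>One-sided derivatives of the norm\<close>

definition norm_slope :: "'a::real_normed_vector \<Rightarrow> 'a \<Rightarrow> real \<Rightarrow> real"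
  where "norm_slope x z t = (norm (x + t *\<^sub>R z) - norm x) / t"

text \<open>By convexity the slopes decrease as \<open>t\<close> decreases to 0, so this infimum is
  the right derivative of the norm at \<open>x\<close> in direction \<open>z\<close>. As an infimum
  it yields sublinearity directly.\<close>

definition norm_deriv :: "'a::real_normed_vector \<Rightarrow> 'a \<Rightarrow> real"
  where "norm_deriv x z = (INF t\<in>{0<..}. norm_slope x z t)"

lemma abs_norm_slope_le: "0 < t \<Longrightarrow> \<bar>norm_slope x z t\<bar> \<le> norm z"
  using norm_triangle_ineq3[of "x + t *\<^sub>R z" x]
  by (simp add: norm_slope_def field_simps abs_le_iff)

lemma bdd_below_norm_slope: "bdd_below (norm_slope x z ` {0<..})"
proof (rule bdd_belowI2)
  fix t :: real assume "t \<in> {0<..}"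
  then show "- norm z \<le> norm_slope x z t" using abs_norm_slope_le[of t x z] by simp
qed

lemma norm_deriv_le_slope: "0 < t \<Longrightarrow> norm_deriv x z \<le> norm_slope x z t"
  unfolding norm_deriv_def by (intro cINF_lower bdd_below_norm_slope) simp

lemma norm_deriv_greatest:
  "(\<And>t. 0 < t \<Longrightarrow> c \<le> norm_slope x z t) \<Longrightarrow> c \<le> norm_deriv x z"
  unfolding norm_deriv_def by (intro cINF_greatest) auto

lemma norm_deriv_le_norm: "norm_deriv x z \<le> norm z"
  using norm_deriv_le_slope[of 1 x z] abs_norm_slope_le[of 1 x z] by simp

text \<open>Convexity of the norm: \<open>x + s *\<^sub>R z\<close> is the convex combination of
  \<open>x\<close> and \<open>x + t *\<^sub>R z\<close> with weights \<open>(t - s) / t\<close> and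
  \<open>s / t\<close>.\<close>

lemma norm_slope_mono:
  assumes "0 < s" "s \<le> t"
  shows "norm_slope x z s \<le> norm_slope x z t"
proof -
  have "t *\<^sub>R (x + s *\<^sub>R z) = (t - s) *\<^sub>R x + s *\<^sub>R (x + t *\<^sub>R z)"
    by (simp add: algebra_simps)
  then have "t * norm (x + s *\<^sub>R z) = norm ((t - s) *\<^sub>R x + s *\<^sub>R (x + t *\<^sub>R z))"
    using assms by (metis abs_of_pos norm_scaleR order_less_le_trans)
  also have "\<dots> \<le> (t - s) * norm x + s * norm (x + t *\<^sub>R z)"
    using assms norm_triangle_ineq[of "(t - s) *\<^sub>R x" "s *\<^sub>R (x + t *\<^sub>R z)"] by simp
  finally show ?thesis using assms by (simp add: norm_slope_def field_simps)
qed

lemma norm_slope_tendsto: "(norm_slope x z \<longlongrightarrow> norm_deriv x z) (at_right 0)"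
proof (rule decreasing_tendsto)
  show "\<forall>\<^sub>F t in at_right 0. norm_deriv x z \<le> norm_slope x z t"
    using norm_deriv_le_slope by (intro eventually_at_rightI[of 0 1]) auto
  fix c assume "norm_deriv x z < c"
  then obtain t where t: "0 < t" "norm_slope x z t < c"
    using norm_deriv_greatest[of c x z] by (meson not_le)
  then show "\<forall>\<^sub>F s in at_right 0. norm_slope x z s < c"
    using norm_slope_mono[of _ t x z] by (force simp: eventually_at_right_field intro!: exI[of _ t])
qed

text \<open>The step \<open>s * t / (s + t)\<close> makes the point on the left the convex
  combination of \<open>x + s *\<^sub>R y\<close> and \<open>x + t *\<^sub>R z\<close> with weights
  \<open>t / (s + t)\<close> and \<open>s / (s + t)\<close>. Independent \<open>s\<close> and
  \<open>t\<close> allow the two infima to be taken separately.\<close>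

lemma norm_slope_add:
  assumes "0 < s" "0 < t"
  shows "norm_slope x (y + z) (s * t / (s + t)) \<le> norm_slope x y s + norm_slope x z t"
proof -
  let ?u = "s * t / (s + t)"
  have "(s + t) *\<^sub>R (x + ?u *\<^sub>R (y + z)) = t *\<^sub>R (x + s *\<^sub>R y) + s *\<^sub>R (x + t *\<^sub>R z)"
  proof -
    have "s + t \<noteq> 0" using assms by simp
    then have "(s + t) *\<^sub>R ?u *\<^sub>R (y + z) = (s * t) *\<^sub>R (y + z)" by simp
    then show ?thesis by (simp only: scaleR_right_distrib) (simp add: algebra_simps)
  qed
  then have "(s + t) * norm (x + ?u *\<^sub>R (y + z)) = norm (t *\<^sub>R (x + s *\<^sub>R y) + s *\<^sub>R (x + t *\<^sub>R z))"
    using assms by (metis abs_of_pos norm_scaleR add_pos_pos)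
  also have "\<dots> \<le> t * norm (x + s *\<^sub>R y) + s * norm (x + t *\<^sub>R z)"
    using assms norm_triangle_ineq[of "t *\<^sub>R (x + s *\<^sub>R y)" "s *\<^sub>R (x + t *\<^sub>R z)"] by simp
  finally have "(s + t) * (norm (x + ?u *\<^sub>R (y + z)) - norm x) / (s * t)
      \<le> (t * (norm (x + s *\<^sub>R y) - norm x) + s * (norm (x + t *\<^sub>R z) - norm x)) / (s * t)"
    using assms by (intro divide_right_mono) (auto simp: algebra_simps)
  then show ?thesis using assms by (simp add: norm_slope_def add_divide_distrib mult.commute)
qed

lemma sublinear_norm_deriv: "sublinear (norm_deriv x)"
proof -
  have add: "norm_deriv x (y + z) \<le> norm_deriv x y + norm_deriv x z" for y z
  proof -
    have *: "norm_deriv x (y + z) \<le> norm_slope x y s + norm_slope x z t" if "0 < s" "0 < t" for s t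
      using norm_deriv_le_slope[of "s * t / (s + t)" x "y + z"] norm_slope_add[OF that, of x y z] that
      by simp
    have "norm_deriv x (y + z) - norm_slope x z t \<le> norm_deriv x y" if "0 < t" for t
      using *[OF _ that] by (intro norm_deriv_greatest) (simp add: algebra_simps)
    then have "norm_deriv x (y + z) - norm_deriv x y \<le> norm_deriv x z"
      by (intro norm_deriv_greatest) (simp add: algebra_simps)
    then show ?thesis by simp
  qed
  have scale: "norm_deriv x (r *\<^sub>R z) \<le> r * norm_deriv x z" if r: "0 < r" for r z
  proof -
    have "norm_deriv x (r *\<^sub>R z) / r \<le> norm_deriv x z"
    proof (rule norm_deriv_greatest)
      fix t :: real assume t: "0 < t"
      have "norm_slope x (r *\<^sub>R z) (t / r) = r * norm_slope x z t"
        using r t by (simp add: norm_slope_def)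
      with norm_deriv_le_slope[of "t / r" x "r *\<^sub>R z"]
      show "norm_deriv x (r *\<^sub>R z) / r \<le> norm_slope x z t" using r t by (simp add: field_simps)
    qed
    with r show ?thesis by (simp add: field_simps)
  qed
  have "norm_deriv x 0 = 0"
    by (simp add: norm_deriv_def norm_slope_def)
  with add scale show ?thesis by (simp add: sublinear_def)
qed

lemma norm_deriv_minus_self: "norm_deriv x (- x) \<le> - norm x"
  using norm_deriv_le_slope[of 1 x "- x"] by (simp add: norm_slope_def)

text \<open>The difference of squares factors into the slope and the mean of the two norms, and this
  mean tends to \<open>norm x\<close>.\<close>

lemma rho_plus_eq: "rho_plus x z = norm x * norm_deriv x z"
  unfolding rho_plus_def
proof (rule tendsto_Lim)
  have "((\<lambda>t. norm (x + t *\<^sub>R z)) \<longlongrightarrow> norm (x + 0 *\<^sub>R z)) (at_right 0)"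
    by (intro tendsto_intros)
  then have "((\<lambda>t. (norm (x + t *\<^sub>R z) + norm x) / 2 * norm_slope x z t) \<longlongrightarrow>
      (norm (x + 0 *\<^sub>R z) + norm x) / 2 * norm_deriv x z) (at_right 0)"
    by (intro tendsto_intros norm_slope_tendsto) auto
  \<comment> \<open>The functions agree at \<open>t = 0\<close> as well, since division by zero
    gives 0 on both sides.\<close>
  also have "(\<lambda>t. (norm (x + t *\<^sub>R z) + norm x) / 2 * norm_slope x z t)
      = (\<lambda>t. ((norm (x + t *\<^sub>R z))\<^sup>2 - (norm x)\<^sup>2) / (2 * t))"
    by (auto simp: norm_slope_def power2_eq_square algebra_simps)
  finally show "((\<lambda>t. ((norm (x + t *\<^sub>R z))\<^sup>2 - (norm x)\<^sup>2) / (2 * t)) \<longlongrightarrow> norm x * norm_deriv x z)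
      (at_right 0)"
    by simp
qed simp

section \<open>Complex functionals supporting a vector\<close>

lemma scaleR_eq_scaleC: "r *\<^sub>R x = complex_of_real r *\<^sub>C x"
  by (simp add: scaleC_of_real)

lemma dual_norm_bound: "cmod (dual_apply f z) \<le> norm f * norm z"
  by transfer (simp add: onorm)

lemma dual_norm_le: "(\<And>z. cmod (dual_apply f z) \<le> b * norm z) \<Longrightarrow> 0 \<le> b \<Longrightarrow> norm f \<le> b"
  by transfer (simp add: onorm_bound)

lemma
  shows dual_apply_add: "dual_apply (f + g) z = dual_apply f z + dual_apply g z"
    and dual_apply_diff: "dual_apply (f - g) z = dual_apply f z - dual_apply g z"
    and dual_apply_scaleR: "dual_apply (r *\<^sub>R f) z = r *\<^sub>R dual_apply f z"
  by (transfer; simp)+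

lemma dual_of_real_linear:
  fixes g :: "'a::complex_normed_vector \<Rightarrow> real"
  assumes g: "linear g" and le: "\<And>z. g z \<le> norm z"
  obtains f :: "'a dual" where "norm f \<le> 1" "\<And>z. Re (dual_apply f z) = g z"
proof -
  \<comment> \<open>Complex linearity forces the imaginary part:
    \<open>Im (h z) = - Re (h (\<i> *\<^sub>C z))\<close>.\<close>
  define h where "h z = Complex (g z) (- g (\<i> *\<^sub>C z))" for z
  have swap: "\<i> *\<^sub>C r *\<^sub>R z = r *\<^sub>R \<i> *\<^sub>C z" for r z
    by (simp add: scaleR_eq_scaleC scaleC_scaleC mult.commute)
  have lin: "linear h"
    by (rule linearI)
      (simp_all add: h_def complex_eq_iff linear_add[OF g] linear_scale[OF g] scaleC_add_right swap)
  have ii: "\<i> *\<^sub>C \<i> *\<^sub>C z = - z" for z :: 'a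
    using scaleC_of_real[of "-1" z] by (simp add: scaleC_scaleC)
  have hi: "h (\<i> *\<^sub>C z) = \<i> * h z" for z
    by (simp add: h_def complex_eq_iff ii linear_neg[OF g])
  have hc: "h (c *\<^sub>C z) = c * h z" for c z
  proof -
    have "c *\<^sub>C z = (complex_of_real (Re c) + complex_of_real (Im c) * \<i>) *\<^sub>C z"
      by (simp add: complex_eq[symmetric] mult.commute)
    also have "\<dots> = Re c *\<^sub>R z + Im c *\<^sub>R \<i> *\<^sub>C z"
      by (simp only: scaleC_add_left scaleC_of_real flip: scaleC_scaleC)
    finally have "h (c *\<^sub>C z) = Re c *\<^sub>R h z + Im c *\<^sub>R (\<i> * h z)"
      by (simp only: linear_add[OF lin] linear_scale[OF lin] hi)
    also have "\<dots> = c * h z"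
      by (simp add: complex_eq_iff)
    finally show ?thesis .
  qed
  have bound: "cmod (h z) \<le> 1 * norm z" for z
  proof -
    \<comment> \<open>This phase rotates \<open>h z\<close> onto the nonnegative real axis, where
      \<open>h\<close> coincides with its real part \<open>g\<close>. If \<open>h z = 0\<close> then
      \<open>c = 0\<close>, hence \<open>cmod c \<le> 1\<close> rather than equality.\<close>
    define c where "c = cnj (sgn (h z))"
    have "cmod c \<le> 1" by (simp add: c_def norm_sgn)
    have "c * h z = complex_of_real (cmod (h z))"
      by (simp add: c_def sgn_eq mult.commute complex_norm_square[symmetric] power2_eq_square)
    then have "cmod (h z) = Re (h (c *\<^sub>C z))" by (simp add: hc)
    also have "\<dots> \<le> norm (c *\<^sub>C z)" using le by (simp add: h_def)
    also have "\<dots> \<le> 1 * norm z"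
      unfolding norm_scaleC using \<open>cmod c \<le> 1\<close> by (rule mult_right_mono) simp
    finally show ?thesis .
  qed
  have bl: "bounded_linear h"
    using lin bound by (intro bounded_linear_intro[where K = 1])
      (auto simp: linear_add linear_scale)
  have ap: "dual_apply (Abs_dual h) = h"
    using bl hc by (intro Abs_dual_inverse) simp
  show thesis
  proof (rule that)
    show "norm (Abs_dual h) \<le> 1" using bound by (intro dual_norm_le) (simp_all add: ap)
    show "Re (dual_apply (Abs_dual h) z) = g z" for z by (simp add: ap h_def)
  qed
qed

text \<open>With \<open>\<le>\<close> in place of equality the condition is visibly convex in
  \<open>f\<close>; for \<open>x \<noteq> 0\<close> the norm is then exactly 1.\<close>

definition supports :: "'a::complex_normed_vector dual \<Rightarrow> 'a \<Rightarrow> bool"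
  where "supports f x \<longleftrightarrow> norm f \<le> 1 \<and> Re (dual_apply f x) = norm x"

text \<open>Any linear \<open>g\<close> dominated by \<open>norm_deriv x\<close> supports
  \<open>x\<close>: at \<open>- x\<close> it is at most \<open>- norm x\<close>, while
  \<open>g x \<le> norm x\<close> holds anyway. Hahn-Banach lets it also attain
  \<open>norm_deriv x\<close> at the given \<open>z\<close>.\<close>

lemma supporting_functional_norm_deriv:
  fixes x z :: "'a::complex_normed_vector"
  obtains f where "supports f x" "Re (dual_apply f z) = norm_deriv x z"
proof -
  obtain g where g: "linear g" "\<And>u. g u \<le> norm_deriv x u" "g z = norm_deriv x z"
    using Hahn_Banach_sublinear[OF sublinear_norm_deriv] by blast
  have le: "g u \<le> norm u" for u
    using g(2)[of u] norm_deriv_le_norm[of x u] by simp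
  obtain f :: "'a dual" where f: "norm f \<le> 1" "\<And>u. Re (dual_apply f u) = g u"
    using dual_of_real_linear[OF g(1) le] by blast
  have "g x = norm x"
    using g(2)[of "- x"] norm_deriv_minus_self[of x] le[of x] linear_neg[OF g(1), of x] by simp
  with f g(3) show thesis by (intro that[of f]) (simp_all add: supports_def)
qed

lemma supports_norm:
  assumes "supports f x" "x \<noteq> 0"
  shows "norm f = 1"
proof -
  have "norm x \<le> norm f * norm x"
    using assms(1) dual_norm_bound[of f x] complex_Re_le_cmod[of "dual_apply f x"]
    by (simp add: supports_def)
  with assms show ?thesis by (simp add: supports_def)
qed

lemma supports_convex:
  assumes "supports f x" "supports g x" "0 \<le> u" "u \<le> 1"
  shows "supports ((1 - u) *\<^sub>R f + u *\<^sub>R g) x"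
proof -
  have "norm ((1 - u) *\<^sub>R f + u *\<^sub>R g) \<le> (1 - u) * norm f + u * norm g"
    using assms norm_triangle_ineq[of "(1 - u) *\<^sub>R f" "u *\<^sub>R g"] by simp
  also have "\<dots> \<le> (1 - u) * 1 + u * 1"
    using assms by (intro add_mono mult_left_mono) (auto simp: supports_def)
  finally have "norm ((1 - u) *\<^sub>R f + u *\<^sub>R g) \<le> 1" by simp
  moreover have "Re (dual_apply ((1 - u) *\<^sub>R f + u *\<^sub>R g) x) = norm x"
    using assms by (simp add: supports_def dual_apply_add dual_apply_scaleR left_diff_distrib)
  ultimately show ?thesis by (simp add: supports_def)
qed

section \<open>Flatness of the dual sphere\<close>

lemma norm_diff_le_sphere_flatness:
  fixes u v :: "'z::real_normed_vector"
  assumes "closed_segment u v \<subseteq> sphere 0 1"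
  shows "norm (u - v) \<le> sphere_flatness TYPE('z)"
  unfolding sphere_flatness_def
proof (rule cSup_upper)
  show "bdd_above {norm (u - v) |u v :: 'z. closed_segment u v \<subseteq> sphere 0 1}"
  proof (rule bdd_aboveI[where M = 2], clarify)
    fix u v :: 'z
    assume "closed_segment u v \<subseteq> sphere 0 1"
    then have "u \<in> sphere 0 1" "v \<in> sphere 0 1" by auto
    then show "norm (u - v) \<le> 2" using norm_triangle_ineq4[of u v] by simp
  qed
qed (use assms in blast)

lemma supports_diff_le:
  fixes f g :: "'a::complex_normed_vector dual"
  assumes "supports f x" "supports g x" "x \<noteq> 0"
  shows "norm (f - g) \<le> sphere_flatness TYPE('a dual)"
proof (rule norm_diff_le_sphere_flatness, rule subsetI)
  fix h assume "h \<in> closed_segment f g"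
  then obtain u where "0 \<le> u" "u \<le> 1" "h = (1 - u) *\<^sub>R f + u *\<^sub>R g"
    by (auto simp: closed_segment_def)
  with assms have "supports h x" by (simp add: supports_convex)
  with assms(3) show "h \<in> sphere 0 1" by (simp add: supports_norm)
qed

section \<open>Averaging over the circle\<close>

lemma has_integral_exp_Re_exp:
  "((\<lambda>\<theta>. exp (\<i> * complex_of_real \<theta>) * complex_of_real (Re (exp (\<i> * complex_of_real \<theta>) * a)))
    has_integral complex_of_real pi * cnj a) {0..2 * pi}"
proof -
  \<comment> \<open>An antiderivative of the form of the integrand found in \<open>re\<close>. Its
    exponential term has equal values at both ends, so only \<open>cnj a / 2\<close> times the
    length \<open>2 * pi\<close> survives.\<close>
  let ?F = "\<lambda>\<theta>. a * exp (2 * \<i> * complex_of_real \<theta>) / (4 * \<i>) + complex_of_real \<theta> * cnj a / 2"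
  have ex: "exp (2 * \<i> * complex_of_real \<theta>) = exp (\<i> * complex_of_real \<theta>) * exp (\<i> * complex_of_real \<theta>)" for \<theta>
    by (simp add: mult.assoc flip: exp_add)
  have un: "exp (\<i> * complex_of_real \<theta>) * cnj (exp (\<i> * complex_of_real \<theta>)) = 1" for \<theta>
    by (simp add: exp_cnj flip: exp_add)
  \<comment> \<open>The real part is half the sum of a number and its conjugate, and the conjugate
    of a unit exponential is its inverse. What remains is a second harmonic plus a constant.\<close>
  have re: "exp (\<i> * complex_of_real \<theta>) * complex_of_real (Re (exp (\<i> * complex_of_real \<theta>) * a))
      = a * exp (2 * \<i> * complex_of_real \<theta>) / 2 + cnj a / 2" for \<theta>
  proof -
    let ?e = "exp (\<i> * complex_of_real \<theta>)"
    have "complex_of_real (Re (?e * a)) = (?e * a + cnj ?e * cnj a) / 2"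
      by (simp add: complex_eq_iff)
    then have "?e * complex_of_real (Re (?e * a)) = (?e * ?e * a + (?e * cnj ?e) * cnj a) / 2"
      by (simp only: distrib_left times_divide_eq_right mult.assoc)
    then show ?thesis unfolding un ex by (simp add: add_divide_distrib mult.commute)
  qed
  have "((\<lambda>\<theta>. a * exp (2 * \<i> * complex_of_real \<theta>) / 2 + cnj a / 2) has_integral ?F (2 * pi) - ?F 0) {0..2 * pi}"
  proof (rule fundamental_theorem_of_calculus)
    fix \<theta> :: real
    have "((\<lambda>w. a * exp (2 * \<i> * w) / (4 * \<i>) + w * cnj a / 2) has_field_derivative
        a * exp (2 * \<i> * complex_of_real \<theta>) / 2 + cnj a / 2) (at (complex_of_real \<theta>))"
      by (auto intro!: derivative_eq_intros simp: field_simps)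
    then show "(?F has_vector_derivative a * exp (2 * \<i> * complex_of_real \<theta>) / 2 + cnj a / 2)
        (at \<theta> within {0..2 * pi})"
      by (rule has_vector_derivative_real_field)
  qed simp
  moreover have "exp (2 * \<i> * complex_of_real (2 * pi)) = 1"
    unfolding ex using exp_two_pi_i by (simp add: mult.commute)
  ultimately show ?thesis unfolding re by simp
qed

theorem theorem2p8:
  fixes x y :: "'a::complex_normed_vector"
  shows "cmod (rho_infty x y) \<le> (1 + 2 * sphere_flatness TYPE('a dual)) * norm x * norm y"
proof (cases "x = 0")
  \<comment> \<open>This case also absorbs the zero space, where \<open>sphere_flatness\<close> is
    unspecified; both sides vanish.\<close>
  case True
  then show ?thesis by (simp add: rho_infty_def rho_plus_eq)
next
  case False
  let ?R = "sphere_flatness TYPE('a dual)"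
  let ?e = "\<lambda>\<theta>. exp (\<i> * complex_of_real \<theta>)"
  let ?F = "\<lambda>\<theta>. ?e \<theta> * complex_of_real (rho_plus x (?e \<theta> *\<^sub>C y))"
  obtain f where f: "supports f x" using supporting_functional_norm_deriv by blast
  \<comment> \<open>Comparing \<open>f\<close> with itself bounds 0 by the flatness.\<close>
  have R: "0 \<le> ?R" using supports_diff_le[OF f f False] by simp
  have err: "\<bar>rho_plus x z - norm x * Re (dual_apply f z)\<bar> \<le> norm x * (?R * norm z)" for z
  proof -
    obtain g where g: "supports g x" "Re (dual_apply g z) = norm_deriv x z"
      by (rule supporting_functional_norm_deriv)
    have "\<bar>norm_deriv x z - Re (dual_apply f z)\<bar> = \<bar>Re (dual_apply (g - f) z)\<bar>"
      by (simp add: g(2) dual_apply_diff)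
    also have "\<dots> \<le> norm (g - f) * norm z"
      using abs_Re_le_cmod dual_norm_bound by (rule order_trans)
    also have "\<dots> \<le> ?R * norm z"
      using supports_diff_le[OF g(1) f False] by (rule mult_right_mono) simp
    finally have "norm x * \<bar>norm_deriv x z - Re (dual_apply f z)\<bar> \<le> norm x * (?R * norm z)"
      by (rule mult_left_mono) simp
    then show ?thesis by (simp add: rho_plus_eq abs_mult flip: right_diff_distrib)
  qed
  show ?thesis
  \<comment> \<open>The split settles integrability: \<open>integral\<close> is 0 on a
    non-integrable function, and then \<open>0 \<le> ?R\<close> suffices.\<close>
  proof (cases "?F integrable_on {0..2 * pi}")
    case int: True
    \<comment> \<open>Chosen so that \<open>?G\<close> is \<open>?F\<close> with
      \<open>rho_plus x\<close> replaced by \<open>norm x\<close> times the real part of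
      \<open>f\<close>.\<close>
    let ?a = "complex_of_real (norm x) * dual_apply f y"
    let ?G = "\<lambda>\<theta>. ?e \<theta> * complex_of_real (Re (?e \<theta> * ?a))"
    let ?I = "integral {0..2 * pi} ?F"
    have "((\<lambda>\<theta>. ?F \<theta> - ?G \<theta>) has_integral ?I - complex_of_real pi * cnj ?a) {0..2 * pi}"
      using integrable_integral[OF int] has_integral_exp_Re_exp by (rule has_integral_diff)
    moreover have "cmod (?F \<theta> - ?G \<theta>) \<le> norm x * (?R * norm y)" for \<theta>
    proof -
      have "?F \<theta> - ?G \<theta> = ?e \<theta> * complex_of_real
          (rho_plus x (?e \<theta> *\<^sub>C y) - norm x * Re (dual_apply f (?e \<theta> *\<^sub>C y)))"
        by (simp add: dual_apply_scaleC algebra_simps)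
      then have "cmod (?F \<theta> - ?G \<theta>)
          = \<bar>rho_plus x (?e \<theta> *\<^sub>C y) - norm x * Re (dual_apply f (?e \<theta> *\<^sub>C y))\<bar>"
        by (simp only: norm_mult norm_of_real) simp
      also have "\<dots> \<le> norm x * (?R * norm (?e \<theta> *\<^sub>C y))" by (rule err)
      finally show ?thesis by (simp add: norm_scaleC)
    qed
    \<comment> \<open>The pointwise error is multiplied by the length \<open>2 * pi\<close> of the
      interval; after division by \<open>pi\<close> this is the factor 2 of the theorem.\<close>
    ultimately have "cmod (?I - complex_of_real pi * cnj ?a)
        \<le> norm x * (?R * norm y) * measure lborel {0..2 * pi}"
      using R by (intro has_integral_bound_real[where S = "{}"]) auto
    then have "cmod (?I - complex_of_real pi * cnj ?a) \<le> 2 * pi * (?R * norm x * norm y)"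
      by (simp add: algebra_simps)
    moreover have "cmod ?a \<le> norm x * norm y"
    proof -
      have "cmod (dual_apply f y) \<le> norm y"
        using dual_norm_bound[of f y] supports_norm[OF f False] by simp
      then show ?thesis by (simp add: norm_mult mult_left_mono)
    qed
    then have "cmod (complex_of_real pi * cnj ?a) \<le> pi * (norm x * norm y)"
      by (simp add: norm_mult)
    \<comment> \<open>The summand 1 comes from the main term \<open>pi * cnj ?a\<close>, the summand
      \<open>2 * ?R\<close> from the error.\<close>
    ultimately have "cmod ?I \<le> pi * ((1 + 2 * ?R) * norm x * norm y)"
      using norm_triangle_sub[of ?I "complex_of_real pi * cnj ?a"] by (simp add: algebra_simps)
    then show ?thesis
      by (simp add: rho_infty_def norm_mult norm_divide field_simps)
  next
    case False
    then have "rho_infty x y = 0" by (simp add: rho_infty_def not_integrable_integral)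
    with R show ?thesis by simp
  qed
qed

end
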